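(* Let $n=n_1+n_2+n_3$ and let $\boldsymbol x=[\boldsymbol q_h^\top\ \boldsymbol p_h^\top\ \boldsymbol x_{co}^\top\ \boldsymbol x_{\bar c\bar o}^\top]^\top$ satisfy $[\boldsymbol x,\boldsymbol x^\top]=\imath\bar{\mathbb J}_n$. Let $\boldsymbol H=\frac12\boldsymbol x^\top H\boldsymbol x$ with $H\in\mathbb R^{2n\times2n}$ symmetric and $\boldsymbol L=\Gamma\boldsymbol x$ with $\Gamma\in\mathbb C^{m\times2n}$. If $\boldsymbol H$ and $\boldsymbol L$ lead to QSDEs in the Kalman canonical form with matrices $$\bar A=\begin{bmatrix} A_h^{11} & A_h^{12} & A_{12} & A_{13} \\ 0 & A_h^{22} & 0 & 0 \\ 0 & A_{21} & A_{co} & 0 \\ 0 & A_{31} & 0 & A_{\bar c\bar o} \end{bmatrix},\quad \bar B=\begin{bmatrix} B_h \\ 0 \\ B_{co} \\ 0 \end{bmatrix},\quad \bar C=\begin{bmatrix} 0 & C_h & C_{co} & 0 \end{bmatrix},$$ then $$H=\begin{bmatrix} 0 & H_h^{12} & 0 & 0 \\ H_h^{12\top} & H_h^{22} & H_{12} & H_{13} \\ 0 & H_{12}^\top & H_{co} & 0 \\ 0 & H_{13}^\top & 0 & H_{\bar c\bar o} \end{bmatrix}$$ where $$\begin{aligned} H_h^{12}&=-A_h^{22},& H_h^{22}&=A_h^{12}-\tfrac12B_h\mathbb J_mB_h^\top,\\ H_{12}&=A_{12}-\tfrac12B_h\mathbb J_mB_{co}^\top\mathbb J_{n_1},& H_{13}&=A_{13},\\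 H_{co}&=-\mathbb J_{n_1}A_{co}+\tfrac12\mathbb J_{n_1}B_{co}\mathbb J_mB_{co}^\top\mathbb J_{n_1},& H_{\bar c\bar o}&=-\mathbb J_{n_2}A_{\bar c\bar o},\end{aligned}$$ and $$\begin{bmatrix} \Gamma \\ \Gamma^{\#} \end{bmatrix}=\begin{bmatrix} 0 & \Gamma_h & \Gamma_{co} & 0 \end{bmatrix},\qquad \Gamma_h=V_m^\dag C_h,\quad \Gamma_{co}=V_m^\dag C_{co}.$$
   Context: Notation: $X^{\#}$ is the entrywise complex conjugate, $X^\dag=(X^{\#})^\top$; $J_k=\mathrm{diag}(I_k,-I_k)$; $\mathbb J_k=\begin{bmatrix} 0 & I_k \\ -I_k & 0 \end{bmatrix}$; $\bar{\mathbb J}_n=\mathrm{diag}(\mathbb J_{n_3},\mathbb J_{n_1},\mathbb J_{n_2})$; $V_k=\frac1{\sqrt2}\begin{bmatrix} I_k & I_k \\ -\imath I_k & \imath I_k \end{bmatrix}$; $\breve\Gamma=\begin{bmatrix} \Gamma \\ \Gamma^{\#} \end{bmatrix}$. The blocks $\boldsymbol q_h,\boldsymbol p_h,\boldsymbol x_{co},\boldsymbol x_{\bar c\bar o}$ have lengths $n_3,n_3,2n_1,2n_2$, and all matrices are partitioned accordingly. QSDEs generated by $(H,\Gamma)$: $\dot{\boldsymbol x}=\bar A\boldsymbol x+\bar B\boldsymbol u$, $\boldsymbol y=\bar C\boldsymbol x+\boldsymbol u$ with the (real) matrices $\bar A=\bar{\mathbb J}_nH-\frac{\imath}{2}\bar{\mathbb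 J}_n\breve\Gamma^\dag J_m\breve\Gamma$, $\bar B=\bar{\mathbb J}_n\breve\Gamma^\dag V_m^\dag\mathbb J_m$, $\bar C=V_m\breve\Gamma$. Kalman canonical form: $(\bar A,\bar B,\bar C)$ has the block form displayed in the claim, the controllable subspace of $(\bar A,\bar B)$ is the span of the $\boldsymbol q_h,\boldsymbol x_{co}$ coordinates, and the unobservable subspace of $(\bar A,\bar C)$ is the span of the $\boldsymbol q_h,\boldsymbol x_{\bar c\bar o}$ coordinates. *)

theory Defs
  imports
    Complex_Main
    "Jordan_Normal_Form.Matrix"
    "Jordan_Normal_Form.Matrix_Kernel"
    "Jordan_Normal_Form.VS_Connect"
begin

(* Horizontal juxtaposition [A B], the companion of the library's vertical append_rows. *)
definition append_cols :: "'a :: zero mat \<Rightarrow> 'a mat \<Rightarrow> 'a mat" (infixr \<open>@\<^sub>c\<close> 70) where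
  "A @\<^sub>c B = four_block_mat A B (0\<^sub>m 0 (dim_col A)) (0\<^sub>m 0 (dim_col B))"

definition dagger :: "complex mat \<Rightarrow> complex mat" where
  "dagger X = (map_mat cnj X)\<^sup>T"

definition sig_J :: "nat \<Rightarrow> 'a :: ring_1 mat" where
  "sig_J k = four_block_mat (1\<^sub>m k) (0\<^sub>m k k) (0\<^sub>m k k) (- 1\<^sub>m k)"

definition symp_J :: "nat \<Rightarrow> 'a :: ring_1 mat" where
  "symp_J k = four_block_mat (0\<^sub>m k k) (1\<^sub>m k) (- 1\<^sub>m k) (0\<^sub>m k k)"

(* Variable ordering: (q_h, p_h) of length 2 n3, then x_co of length 2 n1,
   then x_(not c, not o) of length 2 n2. *)
definition bar_J :: "nat \<Rightarrow> nat \<Rightarrow> nat \<Rightarrow> 'a :: ring_1 mat" where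
  "bar_J n1 n2 n3 = diag_block_mat [symp_J n3, symp_J n1, symp_J n2]"

definition V_mat :: "nat \<Rightarrow> complex mat" where
  "V_mat k = complex_of_real (1 / sqrt 2) \<cdot>\<^sub>m
     four_block_mat (1\<^sub>m k) (1\<^sub>m k) ((- \<i>) \<cdot>\<^sub>m 1\<^sub>m k) (\<i> \<cdot>\<^sub>m 1\<^sub>m k)"

definition doubled :: "complex mat \<Rightarrow> complex mat" where
  "doubled \<Gamma> = \<Gamma> @\<^sub>r map_mat cnj \<Gamma>"

(* Operators are linear endomorphisms of a complex vector space 'v with scalar multiplication s
   (a common invariant domain: commutation relations of this kind have no bounded
   representation on a nonzero space).  The condition is [x_j, x_k] = \<i> J_jk for all j, k < N. *)
definition canonical_commutation ::
    "(complex \<Rightarrow> 'v \<Rightarrow> 'v) \<Rightarrow> nat \<Rightarrow> complex mat \<Rightarrow> (nat \<Rightarrow> 'v \<Rightarrow> 'v :: ab_group_add) \<Rightarrow> bool" where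
  "canonical_commutation s N J x \<longleftrightarrow>
     (\<forall>j<N. Vector_Spaces.linear s s (x j)) \<and>
     (\<forall>j<N. \<forall>k<N. \<forall>v. x j (x k v) - x k (x j v) = s (\<i> * J $$ (j, k)) v)"

definition quadratic_operator ::
    "(complex \<Rightarrow> 'v \<Rightarrow> 'v) \<Rightarrow> nat \<Rightarrow> (nat \<Rightarrow> 'v \<Rightarrow> 'v :: ab_group_add) \<Rightarrow> real mat \<Rightarrow> 'v \<Rightarrow> 'v" where
  "quadratic_operator s N x H v =
     s (1 / 2) (\<Sum>j<N. \<Sum>k<N. s (complex_of_real (H $$ (j, k))) (x j (x k v)))"

definition linear_operator ::
    "(complex \<Rightarrow> 'v \<Rightarrow> 'v) \<Rightarrow> nat \<Rightarrow> (nat \<Rightarrow> 'v \<Rightarrow> 'v :: ab_group_add) \<Rightarrow> complex mat \<Rightarrow> nat \<Rightarrow> 'v \<Rightarrow> 'v" where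
  "linear_operator s N x \<Gamma> i v = (\<Sum>j<N. s (\<Gamma> $$ (i, j)) (x j v))"

(* A, B, C are the coefficients of dx = A x + B u, y = C x + u generated by (H, \<Gamma>).
   The three right-hand sides always have real entries, so taking A, B, C real is no restriction. *)
definition generates_QSDEs ::
    "nat \<Rightarrow> nat \<Rightarrow> nat \<Rightarrow> nat \<Rightarrow> real mat \<Rightarrow> complex mat \<Rightarrow> real mat \<Rightarrow> real mat \<Rightarrow> real mat \<Rightarrow> bool" where
  "generates_QSDEs n1 n2 n3 m H \<Gamma> A B C \<longleftrightarrow>
     map_mat complex_of_real A =
       bar_J n1 n2 n3 * map_mat complex_of_real H
       - (\<i> / 2) \<cdot>\<^sub>m (bar_J n1 n2 n3 * dagger (doubled \<Gamma>) * sig_J m * doubled \<Gamma>) \<and>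
     map_mat complex_of_real B =
       bar_J n1 n2 n3 * dagger (doubled \<Gamma>) * dagger (V_mat m) * symp_J m \<and>
     map_mat complex_of_real C = V_mat m * doubled \<Gamma>"

(* [B, A B, ..., A^(N-1) B] with N the order of A *)
definition controllability_matrix :: "'a :: field mat \<Rightarrow> 'a mat \<Rightarrow> 'a mat" where
  "controllability_matrix A B =
     mat (dim_row A) (dim_row A * dim_col B)
       (\<lambda>(i, j). (A ^\<^sub>m (j div dim_col B) * B) $$ (i, j mod dim_col B))"

(* [C; C A; ...; C A^(N-1)] with N the order of A *)
definition observability_matrix :: "'a :: field mat \<Rightarrow> 'a mat \<Rightarrow> 'a mat" where
  "observability_matrix A C =
     mat (dim_row A * dim_row C) (dim_row A)
       (\<lambda>(i, j). (C * A ^\<^sub>m (i div dim_row C)) $$ (i mod dim_row C, j))"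

definition controllable_subspace :: "'a :: field mat \<Rightarrow> 'a mat \<Rightarrow> 'a vec set" where
  "controllable_subspace A B = vec_space.col_space (dim_row A) (controllability_matrix A B)"

definition unobservable_subspace :: "'a :: field mat \<Rightarrow> 'a mat \<Rightarrow> 'a vec set" where
  "unobservable_subspace A C = mat_kernel (observability_matrix A C)"

definition coordinate_subspace :: "nat \<Rightarrow> nat set \<Rightarrow> real vec set" where
  "coordinate_subspace N S = LinearCombinations.module.span class_ring (module_vec TYPE(real) N) (unit_vec N ` S)"

definition q_h_indices :: "nat \<Rightarrow> nat set" where
  "q_h_indices n3 = {0..<n3}"

definition co_indices :: "nat \<Rightarrow> nat \<Rightarrow> nat set" where
  "co_indices n1 n3 = {2 * n3..<2 * n3 + 2 * n1}"

definition ncno_indices :: "nat \<Rightarrow> nat \<Rightarrow> nat \<Rightarrow> nat set" where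
  "ncno_indices n1 n2 n3 = {2 * n3 + 2 * n1..<2 * n3 + 2 * n1 + 2 * n2}"

(* The block shape together with the meaning of the blocks: without the two subspace
   conditions, the zero pattern alone would allow uncontrollable or unobservable
   directions inside the blocks called "co". *)
definition kalman_canonical_form ::
    "nat \<Rightarrow> nat \<Rightarrow> nat \<Rightarrow> nat \<Rightarrow> real mat \<Rightarrow> real mat \<Rightarrow> real mat \<Rightarrow>
     real mat \<Rightarrow> real mat \<Rightarrow> real mat \<Rightarrow> real mat \<Rightarrow> real mat \<Rightarrow> real mat \<Rightarrow> real mat \<Rightarrow> real mat \<Rightarrow> real mat \<Rightarrow>
     real mat \<Rightarrow> real mat \<Rightarrow> real mat \<Rightarrow> real mat \<Rightarrow> bool" where
  "kalman_canonical_form n1 n2 n3 m A B C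
      Ah11 Ah12 A12 A13 Ah22 A21 Aco A31 Ancno Bh Bco Ch Cco \<longleftrightarrow>
     Ah11 \<in> carrier_mat n3 n3 \<and> Ah12 \<in> carrier_mat n3 n3 \<and>
     A12 \<in> carrier_mat n3 (2 * n1) \<and> A13 \<in> carrier_mat n3 (2 * n2) \<and>
     Ah22 \<in> carrier_mat n3 n3 \<and>
     A21 \<in> carrier_mat (2 * n1) n3 \<and> Aco \<in> carrier_mat (2 * n1) (2 * n1) \<and>
     A31 \<in> carrier_mat (2 * n2) n3 \<and> Ancno \<in> carrier_mat (2 * n2) (2 * n2) \<and>
     Bh \<in> carrier_mat n3 (2 * m) \<and> Bco \<in> carrier_mat (2 * n1) (2 * m) \<and>
     Ch \<in> carrier_mat (2 * m) n3 \<and> Cco \<in> carrier_mat (2 * m) (2 * n1) \<and>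
     A = (Ah11                 @\<^sub>c Ah12 @\<^sub>c A12                         @\<^sub>c A13)
      @\<^sub>r (0\<^sub>m n3 n3           @\<^sub>c Ah22 @\<^sub>c 0\<^sub>m n3 (2 * n1)            @\<^sub>c 0\<^sub>m n3 (2 * n2))
      @\<^sub>r (0\<^sub>m (2 * n1) n3     @\<^sub>c A21  @\<^sub>c Aco                         @\<^sub>c 0\<^sub>m (2 * n1) (2 * n2))
      @\<^sub>r (0\<^sub>m (2 * n2) n3     @\<^sub>c A31  @\<^sub>c 0\<^sub>m (2 * n2) (2 * n1)      @\<^sub>c Ancno) \<and>
     B = Bh @\<^sub>r 0\<^sub>m n3 (2 * m) @\<^sub>r Bco @\<^sub>r 0\<^sub>m (2 * n2) (2 * m) \<and>
     C = 0\<^sub>m (2 * m) n3 @\<^sub>c Ch @\<^sub>c Cco @\<^sub>c 0\<^sub>m (2 * m) (2 * n2) \<and>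
     controllable_subspace A B =
       coordinate_subspace (2 * (n1 + n2 + n3)) (q_h_indices n3 \<union> co_indices n1 n3) \<and>
     unobservable_subspace A C =
       coordinate_subspace (2 * (n1 + n2 + n3)) (q_h_indices n3 \<union> ncno_indices n1 n2 n3)"

end

(* V_m is unitary and V_m J_m V_m^dag = i JJ_m, so the doubled coupling matrix is V_m^dag C and the
   QSDE relations become real: B = JJ C^T JJ_m and A = JJ H + 1/2 JJ C^T JJ_m C. Since JJ^2 = -1,
   with K = JJ B this gives H = - JJ A - 1/2 K JJ_m K^T. Expanding in blocks yields every entry of
   H, except that the (p,q), (co,p) and (ncno,p) blocks come out in terms of Ah11, A21 and A31;
   symmetry of H identifies them with the transposes of the blocks above the diagonal. *)
theory Submission
  imports Defs
begin

section \<open>Calculus of block rows and block columns\<close>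

lemma dim_append_rows [simp]:
  "dim_row (A @\<^sub>r B) = dim_row A + dim_row B" "dim_col (A @\<^sub>r B) = dim_col A"
  by (auto simp: append_rows_def)

lemma dim_append_cols [simp]:
  "dim_row (A @\<^sub>c B) = dim_row A" "dim_col (A @\<^sub>c B) = dim_col A + dim_col B"
  by (auto simp: append_cols_def)

lemma index_append_rows:
  assumes "dim_col B = dim_col A" "i < dim_row A + dim_row B" "j < dim_col A"
  shows "(A @\<^sub>r B) $$ (i, j) = (if i < dim_row A then A $$ (i, j) else B $$ (i - dim_row A, j))"
  using assms by (auto simp: append_rows_def)

lemma index_append_cols:
  assumes "dim_row B = dim_row A" "i < dim_row A" "j < dim_col A + dim_col B"
  shows "(A @\<^sub>c B) $$ (i, j) = (if j < dim_col A then A $$ (i, j) else B $$ (i, j - dim_col A))"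
  using assms by (auto simp: append_cols_def)

text \<open>Only the height of the upper blocks has to be known to agree; the remaining dimensions
  follow from the equation itself. Together with \<open>append_cols_eq_iff\<close> this allows
  single blocks to be read off an equation between right-nested block matrices, by peeling off one
  block at a time.\<close>

lemma append_rows_eq_iff:
  assumes "dim_row A = dim_row A'"
    and "dim_col B = dim_col A" "dim_col B' = dim_col A'"
  shows "A @\<^sub>r B = A' @\<^sub>r B' \<longleftrightarrow> A = A' \<and> B = B'"
proof
  assume eq: "A @\<^sub>r B = A' @\<^sub>r B'"
  have d: "dim_row B = dim_row B'" "dim_col A = dim_col A'"
    using arg_cong[OF eq, of dim_row] arg_cong[OF eq, of dim_col] assms by simp_all
  have "A $$ (i, j) = A' $$ (i, j)" if "i < dim_row A" "j < dim_col A" for i j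
    using arg_cong[OF eq, of "\<lambda>M. M $$ (i, j)"] that assms d by (simp add: index_append_rows)
  moreover have "B $$ (i, j) = B' $$ (i, j)" if "i < dim_row B" "j < dim_col B" for i j
    using arg_cong[OF eq, of "\<lambda>M. M $$ (dim_row A + i, j)"] that assms d
    by (simp add: index_append_rows)
  ultimately show "A = A' \<and> B = B'"
    using assms d by (intro conjI eq_matI) simp_all
qed simp

lemma append_cols_eq_iff:
  assumes "dim_col A = dim_col A'"
    and "dim_row B = dim_row A" "dim_row B' = dim_row A'"
  shows "A @\<^sub>c B = A' @\<^sub>c B' \<longleftrightarrow> A = A' \<and> B = B'"
proof
  assume eq: "A @\<^sub>c B = A' @\<^sub>c B'"
  have d: "dim_col B = dim_col B'" "dim_row A = dim_row A'"
    using arg_cong[OF eq, of dim_row] arg_cong[OF eq, of dim_col] assms by simp_all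
  have "A $$ (i, j) = A' $$ (i, j)" if "i < dim_row A" "j < dim_col A" for i j
    using arg_cong[OF eq, of "\<lambda>M. M $$ (i, j)"] that assms d by (simp add: index_append_cols)
  moreover have "B $$ (i, j) = B' $$ (i, j)" if "i < dim_row B" "j < dim_col B" for i j
    using arg_cong[OF eq, of "\<lambda>M. M $$ (i, dim_col A + j)"] that assms d
    by (simp add: index_append_cols)
  ultimately show "A = A' \<and> B = B'"
    using assms d by (intro conjI eq_matI) simp_all
qed simp

text \<open>A stack of four blocks nests to the right, whereas \<open>bar_J\<close> separates the
  first two blocks from the last two; this law mediates between the groupings.\<close>

lemma append_rows_assoc:
  assumes "dim_col B = dim_col A" "dim_col C = dim_col A"
  shows "(A @\<^sub>r B) @\<^sub>r C = A @\<^sub>r (B @\<^sub>r C)"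
  using assms by (intro eq_matI) (auto simp: index_append_rows)

text \<open>Transposing a stack of block rows gives a juxtaposition of block columns. This law turns
  it back into a stack of block rows, so that a block matrix can be compared with its
  transpose.\<close>

lemma append_interchange:
  assumes "dim_row C = dim_row A" "dim_row D = dim_row B"
    and "dim_col B = dim_col A" "dim_col D = dim_col C"
  shows "(A @\<^sub>r B) @\<^sub>c (C @\<^sub>r D) = (A @\<^sub>c C) @\<^sub>r (B @\<^sub>c D)"
  using assms by (intro eq_matI) (auto simp: index_append_rows index_append_cols)

lemma transpose_append_rows:
  "dim_col B = dim_col A \<Longrightarrow> (A @\<^sub>r B)\<^sup>T = A\<^sup>T @\<^sub>c B\<^sup>T"
  by (intro eq_matI) (auto simp: index_append_rows index_append_cols)

lemma transpose_append_cols: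
  "dim_row B = dim_row A \<Longrightarrow> (A @\<^sub>c B)\<^sup>T = A\<^sup>T @\<^sub>r B\<^sup>T"
  by (intro eq_matI) (auto simp: index_append_rows index_append_cols)

lemma zero_append_cols: "0\<^sub>m a b @\<^sub>c 0\<^sub>m a c = 0\<^sub>m a (b + c)"
  by (intro eq_matI) (auto simp: index_append_cols)

lemma uminus_zero_mat: "- 0\<^sub>m a b = (0\<^sub>m a b :: 'a :: group_add mat)"
  by (intro eq_matI) auto

lemma map_append_cols:
  assumes "dim_row B = dim_row A"
  shows "map_mat f (A @\<^sub>c B) = map_mat f A @\<^sub>c map_mat f B"
  using assms by (intro eq_matI) (auto simp: index_append_cols)

lemma uminus_append_rows:
  fixes A B :: "'a :: group_add mat"
  assumes "dim_col B = dim_col A"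
  shows "- (A @\<^sub>r B) = - A @\<^sub>r - B"
  using assms by (intro eq_matI) (auto simp: index_append_rows)

lemma uminus_append_cols:
  fixes A B :: "'a :: group_add mat"
  assumes "dim_row B = dim_row A"
  shows "- (A @\<^sub>c B) = - A @\<^sub>c - B"
  using assms by (intro eq_matI) (auto simp: index_append_cols)

lemma smult_append_rows:
  fixes A B :: "'a :: mult_zero mat"
  assumes "dim_col B = dim_col A"
  shows "c \<cdot>\<^sub>m (A @\<^sub>r B) = c \<cdot>\<^sub>m A @\<^sub>r c \<cdot>\<^sub>m B"
  using assms by (intro eq_matI) (auto simp: index_append_rows)

lemma smult_append_cols:
  fixes A B :: "'a :: mult_zero mat"
  assumes "dim_row B = dim_row A"
  shows "c \<cdot>\<^sub>m (A @\<^sub>c B) = (c \<cdot>\<^sub>m A) @\<^sub>c (c \<cdot>\<^sub>m B)"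
  using assms by (intro eq_matI) (auto simp: index_append_cols)

lemma minus_append_rows:
  fixes A B :: "'a :: group_add mat"
  assumes "dim_row A = dim_row A'" "dim_row B = dim_row B'" "dim_col A = dim_col A'"
    "dim_col B = dim_col A" "dim_col B' = dim_col A'"
  shows "(A @\<^sub>r B) - (A' @\<^sub>r B') = (A - A') @\<^sub>r (B - B')"
  using assms by (intro eq_matI) (auto simp: index_append_rows)

lemma minus_append_cols:
  fixes A B :: "'a :: group_add mat"
  assumes "dim_col A = dim_col A'" "dim_col B = dim_col B'" "dim_row A = dim_row A'"
    "dim_row B = dim_row A" "dim_row B' = dim_row A'"
  shows "(A @\<^sub>c B) - (A' @\<^sub>c B') = (A - A') @\<^sub>c (B - B')"
  using assms by (intro eq_matI) (auto simp: index_append_cols)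

text \<open>Entries of a product are scalar products with the rows of the left factor, so it
  suffices to know the rows of the stacked matrix.\<close>

lemma mult_append_rows_left:
  fixes A B :: "'a :: semiring_0 mat"
  assumes "dim_col B = dim_col A" "dim_row C = dim_col A"
  shows "(A @\<^sub>r B) * C = A * C @\<^sub>r B * C"
proof -
  have "row (A @\<^sub>r B) i = (if i < dim_row A then row A i else row B (i - dim_row A))"
    if "i < dim_row A + dim_row B" for i
    using assms that by (auto intro!: eq_vecI simp: index_append_rows)
  with assms show ?thesis
    by (intro eq_matI) (auto simp: index_append_rows)
qed

lemma mult_append_cols_right:
  fixes A B :: "'a :: semiring_0 mat"
  assumes "dim_row B = dim_row A" "dim_col C = dim_row A"
  shows "C * (A @\<^sub>c B) = (C * A) @\<^sub>c (C * B)"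
proof -
  have "col (A @\<^sub>c B) j = (if j < dim_col A then col A j else col B (j - dim_col A))"
    if "j < dim_col A + dim_col B" for j
    using assms that by (auto intro!: eq_vecI simp: index_append_cols)
  with assms show ?thesis
    by (intro eq_matI) (auto simp: index_append_cols)
qed

lemma mult_block_diag_append_rows:
  fixes S T :: "'a :: semiring_0 mat"
  assumes "S \<in> carrier_mat a a" "T \<in> carrier_mat b b"
    and "X \<in> carrier_mat a c" "Y \<in> carrier_mat b c"
  shows "four_block_mat S (0\<^sub>m a b) (0\<^sub>m b a) T * (X @\<^sub>r Y) = S * X @\<^sub>r T * Y"
  unfolding append_rows_def using assms
  by (subst mult_four_block_mat[of _ a a _ b _ b]) auto

lemma mult_block_diag:
  fixes S T :: "'a :: semiring_0 mat"
  assumes "S \<in> carrier_mat a a" "T \<in> carrier_mat b b"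
    and "S' \<in> carrier_mat a a" "T' \<in> carrier_mat b b"
  shows "four_block_mat S (0\<^sub>m a b) (0\<^sub>m b a) T * four_block_mat S' (0\<^sub>m a b) (0\<^sub>m b a) T'
    = four_block_mat (S * S') (0\<^sub>m a b) (0\<^sub>m b a) (T * T')"
  using assms
  by (subst mult_four_block_mat[of S a a _ b _ b T S' a _ b]) auto

text \<open>This and the four lemmas after it put the side conditions as equations between
  dimensions rather than carrier memberships, so that they serve as conditional rewrite rules whose
  premises the simplifier can solve.\<close>

lemma mult_mat_assoc:
  fixes A B C :: "'a :: semiring_0 mat"
  shows "dim_col A = dim_row B \<Longrightarrow> dim_col B = dim_row C \<Longrightarrow> A * B * C = A * (B * C)"
  by (rule assoc_mult_mat) auto

lemma smult_mult_mat:
  fixes A B :: "'a :: comm_ring_1 mat"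
  shows "dim_col A = dim_row B \<Longrightarrow> (c \<cdot>\<^sub>m A) * B = c \<cdot>\<^sub>m (A * B)"
  by (rule mult_smult_assoc_mat) auto

lemma mult_smult_mat:
  fixes A B :: "'a :: comm_ring_1 mat"
  shows "dim_col A = dim_row B \<Longrightarrow> A * (c \<cdot>\<^sub>m B) = c \<cdot>\<^sub>m (A * B)"
  by (rule mult_smult_distrib) auto

lemma map_of_real_mult_mat:
  "dim_col A = dim_row B \<Longrightarrow>
    map_mat complex_of_real (A * B) = map_mat complex_of_real A * map_mat complex_of_real B"
  by (rule of_real_hom.mat_hom_mult) auto

lemma transpose_mult_mat:
  fixes A B :: "'a :: comm_semiring_0 mat"
  shows "dim_col A = dim_row B \<Longrightarrow> (A * B)\<^sup>T = B\<^sup>T * A\<^sup>T"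
  by (rule transpose_mult) auto

section \<open>The symplectic matrices\<close>

lemma symp_J_carrier [simp]: "symp_J k \<in> carrier_mat (2 * k) (2 * k)"
  by (rule carrier_matI) (simp_all add: symp_J_def)

lemma dim_symp_J [simp]: "dim_row (symp_J k) = 2 * k" "dim_col (symp_J k) = 2 * k"
  by (simp_all add: symp_J_def)

lemma dim_sig_J [simp]: "dim_row (sig_J k) = 2 * k" "dim_col (sig_J k) = 2 * k"
  by (simp_all add: sig_J_def)

lemma dim_V_mat [simp]: "dim_row (V_mat k) = 2 * k" "dim_col (V_mat k) = 2 * k"
  by (simp_all add: V_mat_def)

lemma transpose_symp_J: "(symp_J k)\<^sup>T = (- symp_J k :: 'a :: ring_1 mat)"
  unfolding symp_J_def by (intro eq_matI) auto

lemma symp_J_mult_append_rows: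
  fixes X Y :: "'a :: ring_1 mat"
  assumes "X \<in> carrier_mat k c" "Y \<in> carrier_mat k c"
  shows "symp_J k * (X @\<^sub>r Y) = Y @\<^sub>r - X"
  unfolding symp_J_def append_rows_def using assms
  by (subst mult_four_block_mat[of _ k k _ k _ k]) auto

lemma symp_J_sq: "symp_J k * symp_J k = (- 1\<^sub>m (2 * k) :: 'a :: ring_1 mat)"
proof -
  have "symp_J k * symp_J k = (four_block_mat (- 1\<^sub>m k) (0\<^sub>m k k) (0\<^sub>m k k) (- 1\<^sub>m k) :: 'a mat)"
    unfolding symp_J_def
    by (subst mult_four_block_mat[of _ k k _ k _ k]) auto
  also have "\<dots> = - 1\<^sub>m (2 * k)"
    by (intro eq_matI) auto
  finally show ?thesis .
qed

text \<open>Nested two-by-two form, splitting off first the \<open>n3\<close> part and then the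
  \<open>n1\<close> part, so that the product rules for two diagonal blocks can be applied
  twice.\<close>

lemma bar_J_eq: "(bar_J n1 n2 n3 :: 'a :: ring_1 mat) =
    four_block_mat (symp_J n3) (0\<^sub>m (2 * n3) (2 * n1 + 2 * n2)) (0\<^sub>m (2 * n1 + 2 * n2) (2 * n3))
      (four_block_mat (symp_J n1) (0\<^sub>m (2 * n1) (2 * n2)) (0\<^sub>m (2 * n2) (2 * n1)) (symp_J n2))"
  using diag_block_mat_singleton[of "symp_J n2 :: 'a mat"]
  by (simp add: bar_J_def Let_def del: diag_block_mat_singleton)

lemma dim_bar_J [simp]:
  "dim_row (bar_J n1 n2 n3) = 2 * (n1 + n2 + n3)" "dim_col (bar_J n1 n2 n3) = 2 * (n1 + n2 + n3)"
  by (simp_all add: bar_J_eq)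

lemma bar_J_mult_append_rows:
  fixes X1 :: "'a :: ring_1 mat"
  assumes "X1 \<in> carrier_mat n3 c" "X2 \<in> carrier_mat n3 c"
    and "X3 \<in> carrier_mat (2 * n1) c" "X4 \<in> carrier_mat (2 * n2) c"
  shows "bar_J n1 n2 n3 * (X1 @\<^sub>r X2 @\<^sub>r X3 @\<^sub>r X4) = X2 @\<^sub>r - X1 @\<^sub>r symp_J n1 * X3 @\<^sub>r symp_J n2 * X4"
proof -
  \<comment> \<open>\<open>X1\<close> and \<open>X2\<close> together have the height
    \<open>2 * n3\<close> of the first diagonal block, which exchanges them and changes one
    sign.\<close>
  have 1: "X1 @\<^sub>r X2 @\<^sub>r X3 @\<^sub>r X4 = (X1 @\<^sub>r X2) @\<^sub>r (X3 @\<^sub>r X4)"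
    and 2: "X2 @\<^sub>r - X1 @\<^sub>r symp_J n1 * X3 @\<^sub>r symp_J n2 * X4
      = (X2 @\<^sub>r - X1) @\<^sub>r (symp_J n1 * X3 @\<^sub>r symp_J n2 * X4)"
    using assms by (simp_all add: append_rows_assoc)
  have c: "X1 @\<^sub>r X2 \<in> carrier_mat (2 * n3) c" "X3 @\<^sub>r X4 \<in> carrier_mat (2 * n1 + 2 * n2) c"
    using assms by auto
  show ?thesis
    unfolding 1 2 bar_J_eq using assms c
    by (simp add: mult_block_diag_append_rows[where c = c] symp_J_mult_append_rows[where c = c])
qed

lemma bar_J_sq: "bar_J n1 n2 n3 * bar_J n1 n2 n3 = (- 1\<^sub>m (2 * (n1 + n2 + n3)) :: 'a :: ring_1 mat)"
proof -
  have "bar_J n1 n2 n3 * bar_J n1 n2 n3 =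
    (four_block_mat (- 1\<^sub>m (2 * n3)) (0\<^sub>m (2 * n3) (2 * n1 + 2 * n2)) (0\<^sub>m (2 * n1 + 2 * n2) (2 * n3))
      (four_block_mat (- 1\<^sub>m (2 * n1)) (0\<^sub>m (2 * n1) (2 * n2)) (0\<^sub>m (2 * n2) (2 * n1)) (- 1\<^sub>m (2 * n2))) :: 'a mat)"
    unfolding bar_J_eq
    by (simp add: mult_block_diag symp_J_sq)
  also have "\<dots> = - 1\<^sub>m (2 * (n1 + n2 + n3))"
    by (intro eq_matI) auto
  finally show ?thesis .
qed

section \<open>Adjoints and the unitary matrix \<open>V_mat\<close>\<close>

lemma dim_dagger [simp]: "dim_row (dagger X) = dim_col X" "dim_col (dagger X) = dim_row X"
  by (simp_all add: dagger_def)

lemma dagger_mult: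
  assumes "dim_col A = dim_row B"
  shows "dagger (A * B) = dagger B * dagger A"
  using assms
  by (intro eq_matI) (auto simp: dagger_def scalar_prod_def mult.commute intro!: sum.cong)

lemma dagger_dagger [simp]: "dagger (dagger X) = X"
  by (intro eq_matI) (auto simp: dagger_def)

lemma dagger_of_real: "dagger (map_mat complex_of_real X) = map_mat complex_of_real X\<^sup>T"
  by (intro eq_matI) (auto simp: dagger_def)

lemma map_of_real_symp_J: "map_mat complex_of_real (symp_J k) = symp_J k"
  by (intro eq_matI) (auto simp: symp_J_def)

lemma map_of_real_bar_J: "map_mat complex_of_real (bar_J n1 n2 n3) = bar_J n1 n2 n3"
proof -
  have "map_mat complex_of_real (0\<^sub>m a b) = 0\<^sub>m a b" for a b
    by (intro eq_matI) auto
  then show ?thesis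
    by (simp add: bar_J_eq map_of_real_symp_J map_four_block_mat[of _ "2 * n3" "2 * n3" _ "2 * n1 + 2 * n2" _ "2 * n1 + 2 * n2"]
        map_four_block_mat[of _ "2 * n1" "2 * n1" _ "2 * n2" _ "2 * n2"])
qed

lemma dagger_V_mat: "dagger (V_mat k) = complex_of_real (1 / sqrt 2) \<cdot>\<^sub>m
     four_block_mat (1\<^sub>m k) (\<i> \<cdot>\<^sub>m 1\<^sub>m k) (1\<^sub>m k) ((- \<i>) \<cdot>\<^sub>m 1\<^sub>m k)"
  by (intro eq_matI) (auto simp: dagger_def V_mat_def)

text \<open>Collects the two normalizing factors into 1/2. The three identities for
  \<open>V_mat\<close> below all reduce to this product.\<close>

lemma mult_inv_sqrt2_four_block_mat:
  fixes A1 :: "complex mat"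
  assumes "A1 \<in> carrier_mat k k" "B1 \<in> carrier_mat k k" "C1 \<in> carrier_mat k k" "D1 \<in> carrier_mat k k"
    and "A2 \<in> carrier_mat k k" "B2 \<in> carrier_mat k k" "C2 \<in> carrier_mat k k" "D2 \<in> carrier_mat k k"
  shows "(complex_of_real (1 / sqrt 2) \<cdot>\<^sub>m four_block_mat A1 B1 C1 D1)
      * (complex_of_real (1 / sqrt 2) \<cdot>\<^sub>m four_block_mat A2 B2 C2 D2)
    = (1 / 2) \<cdot>\<^sub>m four_block_mat (A1 * A2 + B1 * C2) (A1 * B2 + B1 * D2)
        (C1 * A2 + D1 * C2) (C1 * B2 + D1 * D2)"
proof -
  have c: "complex_of_real (1 / sqrt 2) * complex_of_real (1 / sqrt 2) = 1 / 2"
    by (simp flip: of_real_mult)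
  have "(a \<cdot>\<^sub>m X) * (b \<cdot>\<^sub>m Y) = (a * b) \<cdot>\<^sub>m (X * Y)" if "dim_col X = dim_row Y"
    for a b :: complex and X Y
    using that by (intro eq_matI) (auto simp: mult.assoc)
  then show ?thesis
    using assms by (simp only: c mult_four_block_mat[OF assms] index_mat_four_block carrier_matD)
qed

lemma smult_one_mult_mat:
  fixes X :: "'a :: comm_ring_1 mat"
  assumes "dim_row X = k"
  shows "(a \<cdot>\<^sub>m 1\<^sub>m k) * X = a \<cdot>\<^sub>m X"
proof -
  have X: "X \<in> carrier_mat k (dim_col X)"
    using assms by (rule carrier_matI) simp
  show ?thesis
    by (simp add: mult_smult_assoc_mat[OF one_carrier_mat X] left_mult_one_mat[OF X])
qed

lemma V_mat_mult_dagger: "V_mat k * dagger (V_mat k) = 1\<^sub>m (2 * k)"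
  unfolding dagger_V_mat unfolding V_mat_def
  by (subst mult_inv_sqrt2_four_block_mat[of _ k], simp_all add: smult_one_mult_mat) (intro eq_matI, auto)

text \<open>Both orders of the product serve: this one recovers \<open>doubled \<Gamma>\<close> from
  \<open>C\<close>, the other one simplifies the equation for \<open>B\<close>.\<close>

lemma dagger_mult_V_mat: "dagger (V_mat k) * V_mat k = 1\<^sub>m (2 * k)"
  unfolding dagger_V_mat unfolding V_mat_def
  by (subst mult_inv_sqrt2_four_block_mat[of _ k], simp_all add: smult_one_mult_mat) (intro eq_matI, auto)

text \<open>The source of reality: the factor \<i> produced here cancels the imaginary coefficient
  in the equation for \<open>A\<close>.\<close>

lemma V_mat_sig_J: "V_mat k * sig_J k * dagger (V_mat k) = \<i> \<cdot>\<^sub>m symp_J k"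
proof -
  have "V_mat k * sig_J k = complex_of_real (1 / sqrt 2) \<cdot>\<^sub>m
     (four_block_mat (1\<^sub>m k) (1\<^sub>m k) ((- \<i>) \<cdot>\<^sub>m 1\<^sub>m k) (\<i> \<cdot>\<^sub>m 1\<^sub>m k) * sig_J k)"
    unfolding V_mat_def
    by (rule mult_smult_assoc_mat[of _ "k + k" "k + k" _ "k + k"]) (auto simp: sig_J_def)
  \<comment> \<open>Right multiplication by \<open>sig_J\<close> negates the second block
    column.\<close>
  also have "four_block_mat (1\<^sub>m k) (1\<^sub>m k) ((- \<i>) \<cdot>\<^sub>m 1\<^sub>m k) (\<i> \<cdot>\<^sub>m 1\<^sub>m k) * sig_J k =
     four_block_mat (1\<^sub>m k) (- 1\<^sub>m k) ((- \<i>) \<cdot>\<^sub>m 1\<^sub>m k) ((- \<i>) \<cdot>\<^sub>m 1\<^sub>m k)"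
    unfolding sig_J_def
    by (subst mult_four_block_mat[of _ k k _ k _ k]) (auto intro!: cong_four_block_mat eq_matI)
  finally show ?thesis
    unfolding dagger_V_mat symp_J_def
    by (simp only:, subst mult_inv_sqrt2_four_block_mat[of _ k], simp_all add: smult_one_mult_mat)
       (intro eq_matI, auto)
qed

section \<open>The QSDE relations in real form, solved for the Hamiltonian matrix\<close>

lemma generates_QSDEs_doubled:
  assumes "generates_QSDEs n1 n2 n3 m H \<Gamma> A B C" and "\<Gamma> \<in> carrier_mat m N"
  shows "doubled \<Gamma> = dagger (V_mat m) * map_mat complex_of_real C"
proof -
  have G: "doubled \<Gamma> \<in> carrier_mat (2 * m) N"
    using assms(2) by (auto simp: doubled_def)
  have "dagger (V_mat m) * (V_mat m * doubled \<Gamma>) = doubled \<Gamma>"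
    using carrier_matD[OF G] by (simp flip: mult_mat_assoc add: dagger_mult_V_mat)
  with assms(1) show ?thesis
    by (simp add: generates_QSDEs_def)
qed

text \<open>Since \<open>C\<close> is real, the adjoint of the doubled coupling matrix is
  \<open>C\<^sup>T\<close> followed by \<open>V_mat m\<close>. After this substitution every
  \<open>V_mat\<close> meets its adjoint, directly in the equation for \<open>B\<close> and around
  \<open>sig_J\<close> in the one for \<open>A\<close>.\<close>

lemma generates_QSDEs_real:
  assumes gen: "generates_QSDEs n1 n2 n3 m H \<Gamma> A B C"
    and \<Gamma>: "\<Gamma> \<in> carrier_mat m (2 * (n1 + n2 + n3))"
    and H: "H \<in> carrier_mat (2 * (n1 + n2 + n3)) (2 * (n1 + n2 + n3))"
  shows "B = bar_J n1 n2 n3 * C\<^sup>T * symp_J m"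
    and "A = bar_J n1 n2 n3 * H + (1 / 2) \<cdot>\<^sub>m (bar_J n1 n2 n3 * (C\<^sup>T * symp_J m * C))"
proof -
  let ?N = "2 * (n1 + n2 + n3)"
  let ?c = "map_mat complex_of_real" and ?V = "V_mat m" and ?G = "doubled \<Gamma>"
  let ?J = "bar_J n1 n2 n3 :: complex mat"
  have G: "?G \<in> carrier_mat (2 * m) ?N"
    using \<Gamma> by (auto simp: doubled_def)
  have Gd: "?G = dagger ?V * ?c C"
    using generates_QSDEs_doubled[OF gen \<Gamma>] .
  have "?c C = ?V * ?G"
    using gen by (simp add: generates_QSDEs_def)
  \<comment> \<open>No size of \<open>C\<close> is assumed; it is read off the defining
    equation.\<close>
  from arg_cong[OF this, of dim_row] arg_cong[OF this, of dim_col] G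
  have C: "C \<in> carrier_mat (2 * m) ?N"
    by auto
  have dC: "dim_row C = 2 * m" "dim_col C = ?N" and dJ: "dim_col ?J = ?N" "dim_row ?J = ?N"
    using C by auto
  have Gdag: "dagger ?G = ?c C\<^sup>T * ?V"
    unfolding Gd by (subst dagger_mult) (simp_all add: dC dagger_of_real)
  have "?c B = ?J * dagger ?G * dagger ?V * symp_J m"
    using gen by (simp add: generates_QSDEs_def)
  also have "\<dots> = ?J * ?c C\<^sup>T * (?V * dagger ?V) * symp_J m"
    unfolding Gdag by (simp add: mult_mat_assoc dC dJ)
  also have "\<dots> = ?c (bar_J n1 n2 n3 * C\<^sup>T * symp_J m)"
    unfolding V_mat_mult_dagger using dC
    by (simp add: map_of_real_mult_mat map_of_real_bar_J map_of_real_symp_J)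
  \<comment> \<open>Both sides are images of real matrices under the entrywise embedding, which is
    injective.\<close>
  finally show "B = bar_J n1 n2 n3 * C\<^sup>T * symp_J m"
    by (rule of_real_hom.mat_hom_inj)
  have "?J * dagger ?G * sig_J m * ?G = ?J * (?c C\<^sup>T * (?V * sig_J m * dagger ?V) * ?c C)"
    unfolding Gdag unfolding Gd using dC by (simp add: mult_mat_assoc)
  also have "\<dots> = \<i> \<cdot>\<^sub>m (?J * (?c C\<^sup>T * symp_J m * ?c C))"
    unfolding V_mat_sig_J using dC dJ
    by (simp add: smult_mult_mat mult_smult_mat)
  finally have *: "?J * dagger ?G * sig_J m * ?G = \<i> \<cdot>\<^sub>m (?J * (?c C\<^sup>T * symp_J m * ?c C))" .
  have "?c A = ?J * ?c H - (\<i> / 2) \<cdot>\<^sub>m (?J * dagger ?G * sig_J m * ?G)"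
    using gen by (simp add: generates_QSDEs_def)
  \<comment> \<open>The sign flips because (\<i> / 2) * \<i> = - 1 / 2.\<close>
  also have "\<dots> = ?J * ?c H + (1 / 2) \<cdot>\<^sub>m (?J * (?c C\<^sup>T * symp_J m * ?c C))"
    unfolding * using dC dJ H by (intro eq_matI) auto
  also have "\<dots> = ?c (bar_J n1 n2 n3 * H + (1 / 2) \<cdot>\<^sub>m (bar_J n1 n2 n3 * (C\<^sup>T * symp_J m * C)))"
  proof -
    have 1: "?c C\<^sup>T * symp_J m * ?c C = ?c (C\<^sup>T * symp_J m * C)"
      using dC by (simp add: map_of_real_mult_mat map_of_real_symp_J)
    have 2: "?J * ?c X = ?c (bar_J n1 n2 n3 * X)" if "dim_row X = ?N" for X
      using that by (simp add: map_of_real_mult_mat map_of_real_bar_J)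
    have 3: "?c (X + (1 / 2) \<cdot>\<^sub>m Y) = ?c X + (1 / 2) \<cdot>\<^sub>m ?c Y"
      if "dim_row X = dim_row Y" "dim_col X = dim_col Y" for X Y
      using that by (intro eq_matI) auto
    show ?thesis
      using dC carrier_matD[OF H] by (simp add: 1 2 3)
  qed
  finally show "A = bar_J n1 n2 n3 * H + (1 / 2) \<cdot>\<^sub>m (bar_J n1 n2 n3 * (C\<^sup>T * symp_J m * C))"
    by (rule of_real_hom.mat_hom_inj)
qed

text \<open>The correction term is naturally quadratic in \<open>C\<close>; introducing
  \<open>K\<close> rewrites it in terms of \<open>B\<close>, whose blocks are the ones that occur in
  the claimed formulas for \<open>H\<close>.\<close>

lemma hamiltonian_of_QSDEs:
  assumes gen: "generates_QSDEs n1 n2 n3 m H \<Gamma> A B C"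
    and \<Gamma>: "\<Gamma> \<in> carrier_mat m (2 * (n1 + n2 + n3))"
    and H: "H \<in> carrier_mat (2 * (n1 + n2 + n3)) (2 * (n1 + n2 + n3))"
    and C: "C \<in> carrier_mat (2 * m) (2 * (n1 + n2 + n3))"
    and K: "K = bar_J n1 n2 n3 * B"
  shows "H = - (bar_J n1 n2 n3 * A) - (1 / 2) \<cdot>\<^sub>m (K * symp_J m * K\<^sup>T)"
proof -
  let ?N = "2 * (n1 + n2 + n3)"
  let ?J = "bar_J n1 n2 n3 :: real mat"
  have d: "dim_row C = 2 * m" "dim_col C = ?N" "dim_row ?J = ?N" "dim_col ?J = ?N"
      "dim_row H = ?N" "dim_col H = ?N"
    using C H by auto
  have JJ: "?J * (?J * X) = - X" if "dim_row X = ?N" for X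
    using that d bar_J_sq[of n1 n2 n3, where ?'a = real]
    by (simp flip: mult_mat_assoc)
  have SS: "symp_J m * (symp_J m * X) = - X" if "dim_row X = 2 * m" for X :: "real mat"
    using that symp_J_sq[of m, where ?'a = real] by (simp flip: mult_mat_assoc)
  define Q where "Q = C\<^sup>T * (symp_J m * C)"
  have dQ: "dim_row Q = ?N" "dim_col Q = ?N"
    using d by (auto simp: Q_def)
  have "K = - (C\<^sup>T * symp_J m)"
    unfolding K generates_QSDEs_real(1)[OF gen \<Gamma> H] using d by (simp add: mult_mat_assoc JJ)
  \<comment> \<open>The minus sign of \<open>K\<close> is absorbed by the antisymmetry of
    \<open>symp_J\<close>.\<close>
  moreover from this have "K\<^sup>T = symp_J m * C"
    using d by (simp add: transpose_uminus transpose_mult_mat transpose_symp_J)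
  \<comment> \<open>Three factors \<open>symp_J m\<close> meet; two of them contribute -1, which
    cancels the sign of \<open>K\<close>.\<close>
  ultimately have 1: "K * symp_J m * K\<^sup>T = Q"
    using d by (simp add: mult_mat_assoc SS Q_def)
  have "?J * A = ?J * (?J * H) + ?J * ((1 / 2) \<cdot>\<^sub>m (?J * Q))"
    unfolding generates_QSDEs_real(2)[OF gen \<Gamma> H] using d dQ
    by (subst mult_add_distrib_mat[of _ ?N ?N _ ?N]) (auto simp: mult_mat_assoc Q_def)
  also have "\<dots> = - H - (1 / 2) \<cdot>\<^sub>m Q"
    using d dQ by (simp add: JJ mult_smult_mat)
      (intro eq_matI, auto)
  finally have 2: "?J * A = - H - (1 / 2) \<cdot>\<^sub>m Q" .
  show ?thesis
    unfolding 1 2 using d dQ by (intro eq_matI) auto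
qed

section \<open>Blockwise evaluation for the Kalman canonical form\<close>

theorem lemma3p2:
  fixes n n1 n2 n3 m :: nat
    and s :: "complex \<Rightarrow> 'v :: ab_group_add \<Rightarrow> 'v"
    and x :: "nat \<Rightarrow> 'v \<Rightarrow> 'v"
    and Hop :: "'v \<Rightarrow> 'v" and Lop :: "nat \<Rightarrow> 'v \<Rightarrow> 'v"
    and H :: "real mat" and \<Gamma> :: "complex mat"
    and A B C :: "real mat"
    and Ah11 Ah12 A12 A13 Ah22 A21 Aco A31 Ancno Bh Bco Ch Cco :: "real mat"
  assumes "n = n1 + n2 + n3"
    and "vector_space s"
    and "canonical_commutation s (2 * n) (bar_J n1 n2 n3) x"
    and "H \<in> carrier_mat (2 * n) (2 * n)" and "H\<^sup>T = H"
    and "\<Gamma> \<in> carrier_mat m (2 * n)"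
    and "Hop = quadratic_operator s (2 * n) x H"
    and "\<forall>i<m. Lop i = linear_operator s (2 * n) x \<Gamma> i"
    and "generates_QSDEs n1 n2 n3 m H \<Gamma> A B C"
    and "kalman_canonical_form n1 n2 n3 m A B C
           Ah11 Ah12 A12 A13 Ah22 A21 Aco A31 Ancno Bh Bco Ch Cco"
  shows
    "let Hh12 = - Ah22;
         Hh22 = Ah12 - (1 / 2) \<cdot>\<^sub>m (Bh * symp_J m * Bh\<^sup>T);
         H12 = A12 - (1 / 2) \<cdot>\<^sub>m (Bh * symp_J m * Bco\<^sup>T * symp_J n1);
         H13 = A13;
         Hco = - symp_J n1 * Aco + (1 / 2) \<cdot>\<^sub>m (symp_J n1 * Bco * symp_J m * Bco\<^sup>T * symp_J n1);
         Hncno = - symp_J n2 * Ancno;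
         \<Gamma>h = dagger (V_mat m) * map_mat complex_of_real Ch;
         \<Gamma>co = dagger (V_mat m) * map_mat complex_of_real Cco
     in H = (0\<^sub>m n3 n3       @\<^sub>c Hh12   @\<^sub>c 0\<^sub>m n3 (2 * n1)       @\<^sub>c 0\<^sub>m n3 (2 * n2))
         @\<^sub>r (Hh12\<^sup>T         @\<^sub>c Hh22   @\<^sub>c H12                   @\<^sub>c H13)
         @\<^sub>r (0\<^sub>m (2 * n1) n3 @\<^sub>c H12\<^sup>T   @\<^sub>c Hco                   @\<^sub>c 0\<^sub>m (2 * n1) (2 * n2))
         @\<^sub>r (0\<^sub>m (2 * n2) n3 @\<^sub>c H13\<^sup>T   @\<^sub>c 0\<^sub>m (2 * n2) (2 * n1) @\<^sub>c Hncno) \<and>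
        \<Gamma> @\<^sub>r map_mat cnj \<Gamma> =
          0\<^sub>m (2 * m) n3 @\<^sub>c \<Gamma>h @\<^sub>c \<Gamma>co @\<^sub>c 0\<^sub>m (2 * m) (2 * n2)"
proof -
  let ?J1 = "symp_J n1 :: real mat" and ?J2 = "symp_J n2 :: real mat" and ?Jm = "symp_J m :: real mat"
  let ?N = "2 * (n1 + n2 + n3)"
  note gen = assms(9)
  have \<Gamma>: "\<Gamma> \<in> carrier_mat m (2 * (n1 + n2 + n3))"
    and H: "H \<in> carrier_mat (2 * (n1 + n2 + n3)) (2 * (n1 + n2 + n3))"
    using assms(1,4,6) by auto
  have
    car: "Ah11 \<in> carrier_mat n3 n3" "Ah12 \<in> carrier_mat n3 n3"
      "A12 \<in> carrier_mat n3 (2 * n1)" "A13 \<in> carrier_mat n3 (2 * n2)"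
      "Ah22 \<in> carrier_mat n3 n3"
      "A21 \<in> carrier_mat (2 * n1) n3" "Aco \<in> carrier_mat (2 * n1) (2 * n1)"
      "A31 \<in> carrier_mat (2 * n2) n3" "Ancno \<in> carrier_mat (2 * n2) (2 * n2)"
      "Bh \<in> carrier_mat n3 (2 * m)" "Bco \<in> carrier_mat (2 * n1) (2 * m)"
      "Ch \<in> carrier_mat (2 * m) n3" "Cco \<in> carrier_mat (2 * m) (2 * n1)"
    and A: "A = (Ah11                 @\<^sub>c Ah12 @\<^sub>c A12                         @\<^sub>c A13)
      @\<^sub>r (0\<^sub>m n3 n3           @\<^sub>c Ah22 @\<^sub>c 0\<^sub>m n3 (2 * n1)            @\<^sub>c 0\<^sub>m n3 (2 * n2))
      @\<^sub>r (0\<^sub>m (2 * n1) n3     @\<^sub>c A21  @\<^sub>c Aco                         @\<^sub>c 0\<^sub>m (2 * n1) (2 * n2))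
      @\<^sub>r (0\<^sub>m (2 * n2) n3     @\<^sub>c A31  @\<^sub>c 0\<^sub>m (2 * n2) (2 * n1)      @\<^sub>c Ancno)"
    and B: "B = Bh @\<^sub>r 0\<^sub>m n3 (2 * m) @\<^sub>r Bco @\<^sub>r 0\<^sub>m (2 * n2) (2 * m)"
    and C: "C = 0\<^sub>m (2 * m) n3 @\<^sub>c Ch @\<^sub>c Cco @\<^sub>c 0\<^sub>m (2 * m) (2 * n2)"
    using assms(10) unfolding kalman_canonical_form_def by blast+
  note dims = car[THEN carrier_matD(1)] car[THEN carrier_matD(2)]
  have C_car: "C \<in> carrier_mat (2 * m) (2 * (n1 + n2 + n3))"
    by (rule carrier_matI) (simp_all add: C dims)

  have G: "\<Gamma> @\<^sub>r map_mat cnj \<Gamma> = 0\<^sub>m (2 * m) n3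
      @\<^sub>c (dagger (V_mat m) * map_mat complex_of_real Ch)
      @\<^sub>c (dagger (V_mat m) * map_mat complex_of_real Cco) @\<^sub>c 0\<^sub>m (2 * m) (2 * n2)"
  proof -
    have z: "map_mat complex_of_real (0\<^sub>m a b) = 0\<^sub>m a b" for a b
      by (intro eq_matI) auto
    show ?thesis
      using generates_QSDEs_doubled[OF gen \<Gamma>] unfolding doubled_def C
      by (simp add: map_append_cols mult_append_cols_right dims z)
  qed

  \<comment> \<open>The q and p block rows change places, the former q row with a minus sign. This
    is why \<open>Ah22\<close> ends up in the first row of \<open>H\<close> and \<open>Ah12\<close>
    in the second.\<close>
  have JA: "bar_J n1 n2 n3 * A =
         (0\<^sub>m n3 n3 @\<^sub>c Ah22 @\<^sub>c 0\<^sub>m n3 (2 * n1) @\<^sub>c 0\<^sub>m n3 (2 * n2))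
      @\<^sub>r - (Ah11 @\<^sub>c Ah12 @\<^sub>c A12 @\<^sub>c A13)
      @\<^sub>r ?J1 * (0\<^sub>m (2 * n1) n3 @\<^sub>c A21 @\<^sub>c Aco @\<^sub>c 0\<^sub>m (2 * n1) (2 * n2))
      @\<^sub>r ?J2 * (0\<^sub>m (2 * n2) n3 @\<^sub>c A31 @\<^sub>c 0\<^sub>m (2 * n2) (2 * n1) @\<^sub>c Ancno)"
    unfolding A by (rule bar_J_mult_append_rows[where c = ?N]; rule carrier_matI) (simp_all add: dims)
  define K where "K = bar_J n1 n2 n3 * B"
  have K: "K = 0\<^sub>m n3 (2 * m) @\<^sub>r - Bh @\<^sub>r ?J1 * Bco @\<^sub>r 0\<^sub>m (2 * n2) (2 * m)"
    unfolding K_def B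
    by (subst bar_J_mult_append_rows[where c = "2 * m"]) (simp_all add: car)
  \<comment> \<open>The two minus signs have different origins: the first is already in
    \<open>K\<close>, the second comes from transposing the antisymmetric
    \<open>?J1\<close>.\<close>
  have KT: "K\<^sup>T = 0\<^sub>m (2 * m) n3 @\<^sub>c - Bh\<^sup>T @\<^sub>c - (Bco\<^sup>T * ?J1) @\<^sub>c 0\<^sub>m (2 * m) (2 * n2)"
  proof -
    have "(?J1 * Bco)\<^sup>T = - (Bco\<^sup>T * ?J1)"
      by (simp add: transpose_mult_mat transpose_symp_J dims)
    then show ?thesis
      unfolding K by (simp add: transpose_append_rows transpose_uminus dims)
  qed
  have z: "0\<^sub>m a b * X = 0\<^sub>m a (dim_col X)" "X * 0\<^sub>m c d = 0\<^sub>m (dim_row X) d"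
    if "dim_row X = b" "dim_col X = c" for a b c d and X :: "real mat"
    using that by (auto intro: left_mult_zero_mat right_mult_zero_mat)
  \<comment> \<open>With a general right factor, the block rows of \<open>K\<close> are separated
    before the block columns of \<open>K\<^sup>T\<close> are inserted.\<close>
  have KJ: "K * ?Jm * X = 0\<^sub>m n3 (dim_col X) @\<^sub>r - (Bh * (?Jm * X)) @\<^sub>r ?J1 * (Bco * (?Jm * X))
      @\<^sub>r 0\<^sub>m (2 * n2) (dim_col X)" if "dim_row X = 2 * m" for X
    using that unfolding K by (simp add: mult_append_rows_left mult_mat_assoc dims z)
  \<comment> \<open>The (co, p) block as the computation delivers it, left unsimplified because
    symmetry will replace it by \<open>?h12\<^sup>T\<close>.\<close>
  let ?W = "- (?J1 * A21) - (1 / 2) \<cdot>\<^sub>m (?J1 * (Bco * (?Jm * - Bh\<^sup>T)))"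
  let ?h22 = "Ah12 - (1 / 2) \<cdot>\<^sub>m (Bh * ?Jm * Bh\<^sup>T)"
  let ?h12 = "A12 - (1 / 2) \<cdot>\<^sub>m (Bh * ?Jm * Bco\<^sup>T * ?J1)"
  let ?hco = "- ?J1 * Aco + (1 / 2) \<cdot>\<^sub>m (?J1 * Bco * ?Jm * Bco\<^sup>T * ?J1)"
  have neg: "0\<^sub>m a b - X = - X" "X - 0\<^sub>m a b = X" "c \<cdot>\<^sub>m (- X) = - (c \<cdot>\<^sub>m X)"
    if "dim_row X = a" "dim_col X = b" for a b c and X :: "real mat"
    using that by (auto intro!: eq_matI)
  have neg2: "X - - Y = X + Y" if "dim_row X = dim_row Y" "dim_col X = dim_col Y" for X Y :: "real mat"
    using that by (auto intro!: eq_matI)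
  have "H = - (bar_J n1 n2 n3 * A) - (1 / 2) \<cdot>\<^sub>m (K * ?Jm * K\<^sup>T)"
    by (rule hamiltonian_of_QSDEs[OF gen \<Gamma> H C_car K_def])
  \<comment> \<open>The nonzero block rows and columns are those of p and co. Two minus signs cancel
    in the (p, p) and (p, co) blocks; a single one survives in the (co, co) block and makes the
    correction in \<open>?hco\<close> positive.\<close>
  also have "K * ?Jm * K\<^sup>T =
       (0\<^sub>m n3 n3 @\<^sub>c 0\<^sub>m n3 n3 @\<^sub>c 0\<^sub>m n3 (2 * n1) @\<^sub>c 0\<^sub>m n3 (2 * n2))
    @\<^sub>r (0\<^sub>m n3 n3 @\<^sub>c (Bh * (?Jm * Bh\<^sup>T)) @\<^sub>c (Bh * (?Jm * (Bco\<^sup>T * ?J1))) @\<^sub>c 0\<^sub>m n3 (2 * n2))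
    @\<^sub>r (0\<^sub>m (2 * n1) n3 @\<^sub>c (?J1 * (Bco * (?Jm * - Bh\<^sup>T)))
        @\<^sub>c - (?J1 * (Bco * (?Jm * (Bco\<^sup>T * ?J1)))) @\<^sub>c 0\<^sub>m (2 * n1) (2 * n2))
    @\<^sub>r (0\<^sub>m (2 * n2) n3 @\<^sub>c 0\<^sub>m (2 * n2) n3 @\<^sub>c 0\<^sub>m (2 * n2) (2 * n1) @\<^sub>c 0\<^sub>m (2 * n2) (2 * n2))"
    using KJ[of "K\<^sup>T"] unfolding KT
    by (simp add: mult_append_cols_right uminus_append_cols zero_append_cols uminus_zero_mat dims z)
  also have "- (bar_J n1 n2 n3 * A) - (1 / 2) \<cdot>\<^sub>m \<dots> =
       (0\<^sub>m n3 n3 @\<^sub>c - Ah22 @\<^sub>c 0\<^sub>m n3 (2 * n1) @\<^sub>c 0\<^sub>m n3 (2 * n2))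
    @\<^sub>r (Ah11 @\<^sub>c ?h22 @\<^sub>c ?h12 @\<^sub>c A13)
    @\<^sub>r (0\<^sub>m (2 * n1) n3 @\<^sub>c ?W @\<^sub>c ?hco @\<^sub>c 0\<^sub>m (2 * n1) (2 * n2))
    @\<^sub>r (0\<^sub>m (2 * n2) n3 @\<^sub>c - (?J2 * A31) @\<^sub>c 0\<^sub>m (2 * n2) (2 * n1) @\<^sub>c (- ?J2 * Ancno))"
    unfolding JA
    by (simp add: mult_append_cols_right uminus_append_rows uminus_append_cols smult_append_rows
        smult_append_cols minus_append_rows minus_append_cols mult_mat_assoc uminus_zero_mat dims z neg neg2)
  finally have HE: "H = \<dots>" .
  have "H\<^sup>T = H" by fact
  then have sym: "Ah11 = (- Ah22)\<^sup>T" "?W = ?h12\<^sup>T" "- (?J2 * A31) = A13\<^sup>T"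
    unfolding HE
    by (simp_all add: transpose_append_rows transpose_append_cols append_interchange
        append_rows_eq_iff append_cols_eq_iff dims)
  show ?thesis
    \<comment> \<open>Rewriting with \<open>sym\<close> puts the transposes into the three blocks
      left of the diagonal, after which \<open>HE\<close> has literally the claimed form.\<close>
    unfolding Let_def using HE[unfolded sym] G by blast
qed

end
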